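(* For any refinement mapping $m$ from a high-level BAT $\mathcal{D}_h$ to a low-level BAT $\mathcal{D}_l$: (1) $\mathcal{D}_l\cup\mathcal{C}\models\forall s\exists s'.\,lp_m(s,s')$; and (2) $\mathcal{D}_l\cup\mathcal{C}\models\forall s\forall s_1\forall s_2.\,lp_m(s,s_1)\land lp_m(s,s_2)\supset s_1=s_2$.
   Context: Situation calculus setting. Objects are a countably infinite set $\mathcal{N}$ of standard names (unique names and domain closure); no function symbols other than constants; no non-fluent predicates. Situations: $S_0$ and $do(a,s)$. $Poss(a,s)$ means $a$ is executable in $s$; $s<s'$ means $s'$ is obtained from $s$ by a nonempty sequence of actions each possible in the situation where it is performed, and $s\le s'$ means $s=s'\lor s<s'$. A basic action theory (BAT) over finitely many action types $\mathcal{A}$ and fluents $\mathcal{F}$ is the union of: initial-state axioms $\mathcal{D}_{S_0}$; precondition axioms $Poss(A(\vec x),s)\equiv\phi^{Poss}_A(\vec x,s)$; successor state axioms $F(\vec x,do(a,s))\equiv\phi^{ssa}_F(\vec x,a,s)$ (right-hand sides uniform in $s$); $\mathcal{D}_{ca}$, unique names and domain closure for actions; $\mathcal{D}_{coa}$, unique names and domain closure for objects; and the foundational axioms $\Sigma$ of the situation calculus. A situation-suppressed formula omits situation arguments of fluents; $\phi[s]$ restores $s$. ConGolog programs $\delta::=\alpha\mid\varphi?\mid\delta_1;\delta_2\mid\delta_1|\delta_2\mid\pi x.\delta\mid\delta^*\mid\delta_1\|\delta_2$, $nil=True?$; $\mathcal{C}$ are the axioms: $Trans(\alpha,s,\delta',s')\equiv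 s'=do(\alpha,s)\land Poss(\alpha,s)\land\delta'=True?$; $Trans(\varphi?,s,\delta',s')\equiv False$; $Trans(\delta_1;\delta_2,s,\delta',s')\equiv\exists\delta_1'(Trans(\delta_1,s,\delta_1',s')\land\delta'=\delta_1';\delta_2)\lor(Final(\delta_1,s)\land Trans(\delta_2,s,\delta',s'))$; $Trans(\delta_1|\delta_2,\cdot)\equiv Trans(\delta_1,\cdot)\lor Trans(\delta_2,\cdot)$; $Trans(\pi x.\delta,s,\delta',s')\equiv\exists x.Trans(\delta,s,\delta',s')$; $Trans(\delta^*,s,\delta',s')\equiv\exists\delta''(Trans(\delta,s,\delta'',s')\land\delta'=\delta'';\delta^* )$; $Trans(\delta_1\|\delta_2,s,\delta',s')\equiv\exists\delta_1'(Trans(\delta_1,s,\delta_1',s')\land\delta'=\delta_1'\|\delta_2)\lor\exists\delta_2'(Trans(\delta_2,s,\delta_2',s')\land\delta'=\delta_1\|\delta_2')$; $Final(\alpha,s)\equiv False$; $Final(\varphi?,s)\equiv\varphi[s]$; $Final(\delta_1;\delta_2,s)\equiv Final(\delta_1,s)\land Final(\delta_2,s)$; $Final(\delta_1|\delta_2,s)\equiv Final(\delta_1,s)\lor Final(\delta_2,s)$; $Final(\pi x.\delta,s)\equiv\exists x.Final(\delta,s)$; $Final(\delta^*,s)\equiv True$; $Final(\delta_1\|\delta_2,s)\equiv Final(\delta_1,s)\land Final(\delta_2,s)$. $Do(\delta,s,s')\doteq\exists\delta'.Trans^*(\delta,s,\delta',s')\land Final(\delta',s')$, $Trans^*$ the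 reflexive transitive closure. $\mathcal{D}_h$ and $\mathcal{D}_l$ have action types $\mathcal{A}_h,\mathcal{A}_l$ and fluents $\mathcal{F}_h,\mathcal{F}_l$, sharing only $\mathcal{N}$. A refinement mapping $m$ maps each $A\in\mathcal{A}_h$ to a situation-determined ConGolog program $m(A(\vec x))$ over $\mathcal{D}_l$ with free variables $\vec x$, and each $F\in\mathcal{F}_h$ to a situation-suppressed low-level formula $m(F(\vec x))$. $\textsc{any1hl}\doteq|_{A_i\in\mathcal{A}_h}\pi\vec x.\,m(A_i(\vec x))$, $\textsc{anyseqhl}\doteq\textsc{any1hl}^*$, and $lp_m(s,s')\doteq Do(\textsc{anyseqhl},S_0,s')\land s'\le s\land\forall s''.(s'<s''\le s\supset\neg Do(\textsc{anyseqhl},S_0,s''))$ ($s'$ is a largest prefix of $s$ producible by executing refinements of a sequence of high-level actions).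
   Formalization: Part (1) is stated only for executable situations s (those with S_0 ≤ s); for non-executable s it fails, e.g. s = do(A,S_0) with A never possible, since lp_m(s,s') forces S_0 ≤ s' ≤ s. Part (2) is for all s. *)

theory Defs
  imports "HOL-Library.Countable" "HOL-Library.Infinite_Typeclass"
begin

text \<open>Type variables: \<open>'n\<close> standard names, \<open>'a\<close> action symbols, \<open>'f\<close> fluent symbols;
  \<open>'o\<close>, \<open>'e\<close>, \<open>'s\<close> are the domains of objects, actions and situations of a structure.\<close>

type_synonym var = nat

datatype 'n tm = Var var | Name 'n

datatype ('a, 'n) atm = AVar var | Act 'a "'n tm list"

text \<open>Situation-suppressed formulas. Restoring one situation in all fluents gives exactly
  the formulas uniform in that situation, which may quantify over objects and actions.\<close>

datatype ('a, 'f, 'n) fm =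
    FTrue
  | Fluent 'f "'n tm list"
  | EqO "'n tm" "'n tm"
  | EqA "('a, 'n) atm" "('a, 'n) atm"
  | Neg "('a, 'f, 'n) fm"
  | Conj "('a, 'f, 'n) fm" "('a, 'f, 'n) fm"
  | FEx var "('a, 'f, 'n) fm"
  | FAEx var "('a, 'f, 'n) fm"

datatype ('a, 'f, 'n) prog =
    Prim 'a "'n tm list"
  | Test "('a, 'f, 'n) fm"
  | Seq "('a, 'f, 'n) prog" "('a, 'f, 'n) prog"
  | Choice "('a, 'f, 'n) prog" "('a, 'f, 'n) prog"
  | Pi var "('a, 'f, 'n) prog"
  | Star "('a, 'f, 'n) prog"
  | Conc "('a, 'f, 'n) prog" "('a, 'f, 'n) prog"

definition nil :: "('a, 'f, 'n) prog" where
  "nil = Test FTrue"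

section \<open>Free variables and substitution of standard names\<close>

fun tfv :: "'n tm \<Rightarrow> var set" where
  "tfv (Var x) = {x}"
| "tfv (Name n) = {}"

fun atfv :: "('a, 'n) atm \<Rightarrow> var set" where
  "atfv (AVar v) = {}"
| "atfv (Act A ts) = (\<Union>t\<in>set ts. tfv t)"

fun atafv :: "('a, 'n) atm \<Rightarrow> var set" where
  "atafv (AVar v) = {v}"
| "atafv (Act A ts) = {}"

primrec fv :: "('a, 'f, 'n) fm \<Rightarrow> var set" where
  "fv FTrue = {}"
| "fv (Fluent F ts) = (\<Union>t\<in>set ts. tfv t)"
| "fv (EqO t u) = tfv t \<union> tfv u"
| "fv (EqA a b) = atfv a \<union> atfv b"
| "fv (Neg p) = fv p"
| "fv (Conj p q) = fv p \<union> fv q"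
| "fv (FEx x p) = fv p - {x}"
| "fv (FAEx v p) = fv p"

primrec afv :: "('a, 'f, 'n) fm \<Rightarrow> var set" where
  "afv FTrue = {}"
| "afv (Fluent F ts) = {}"
| "afv (EqO t u) = {}"
| "afv (EqA a b) = atafv a \<union> atafv b"
| "afv (Neg p) = afv p"
| "afv (Conj p q) = afv p \<union> afv q"
| "afv (FEx x p) = afv p"
| "afv (FAEx v p) = afv p - {v}"

primrec pfv :: "('a, 'f, 'n) prog \<Rightarrow> var set" where
  "pfv (Prim A ts) = (\<Union>t\<in>set ts. tfv t)"
| "pfv (Test p) = fv p"
| "pfv (Seq d e) = pfv d \<union> pfv e"
| "pfv (Choice d e) = pfv d \<union> pfv e"
| "pfv (Pi x d) = pfv d - {x}"
| "pfv (Star d) = pfv d"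
| "pfv (Conc d e) = pfv d \<union> pfv e"

fun tsubst :: "var \<Rightarrow> 'n \<Rightarrow> 'n tm \<Rightarrow> 'n tm" where
  "tsubst x n (Var y) = (if y = x then Name n else Var y)"
| "tsubst x n (Name k) = Name k"

fun atsubst :: "var \<Rightarrow> 'n \<Rightarrow> ('a, 'n) atm \<Rightarrow> ('a, 'n) atm" where
  "atsubst x n (AVar v) = AVar v"
| "atsubst x n (Act A ts) = Act A (map (tsubst x n) ts)"

primrec fsubst :: "var \<Rightarrow> 'n \<Rightarrow> ('a, 'f, 'n) fm \<Rightarrow> ('a, 'f, 'n) fm" where
  "fsubst x n FTrue = FTrue"
| "fsubst x n (Fluent F ts) = Fluent F (map (tsubst x n) ts)"
| "fsubst x n (EqO t u) = EqO (tsubst x n t) (tsubst x n u)"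
| "fsubst x n (EqA a b) = EqA (atsubst x n a) (atsubst x n b)"
| "fsubst x n (Neg p) = Neg (fsubst x n p)"
| "fsubst x n (Conj p q) = Conj (fsubst x n p) (fsubst x n q)"
| "fsubst x n (FEx y p) = FEx y (if y = x then p else fsubst x n p)"
| "fsubst x n (FAEx v p) = FAEx v (fsubst x n p)"

primrec psubst :: "var \<Rightarrow> 'n \<Rightarrow> ('a, 'f, 'n) prog \<Rightarrow> ('a, 'f, 'n) prog" where
  "psubst x n (Prim A ts) = Prim A (map (tsubst x n) ts)"
| "psubst x n (Test p) = Test (fsubst x n p)"
| "psubst x n (Seq d e) = Seq (psubst x n d) (psubst x n e)"
| "psubst x n (Choice d e) = Choice (psubst x n d) (psubst x n e)"
| "psubst x n (Pi y d) = Pi y (if y = x then d else psubst x n d)"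
| "psubst x n (Star d) = Star (psubst x n d)"
| "psubst x n (Conc d e) = Conc (psubst x n d) (psubst x n e)"

text \<open>Throughout, the formal parameters of a \<open>k\<close>-ary symbol are the object variables
  \<open>0, \<dots>, k - 1\<close>.\<close>

definition inst :: "'n list \<Rightarrow> ('a, 'f, 'n) prog \<Rightarrow> ('a, 'f, 'n) prog" where
  "inst ns d = fold (\<lambda>(x, n). psubst x n) (enumerate 0 ns) d"

section \<open>Basic action theories\<close>

text \<open>\<open>pre A\<close> is the right-hand side of the precondition axiom of \<open>A\<close>, and \<open>ssa F\<close> that of the
  successor state axiom of \<open>F\<close>, in which the action argument is the action variable \<open>0\<close>.\<close>

record ('a, 'f, 'n) bat =
  acts :: "'a list"
  aar :: "'a \<Rightarrow> nat"
  fluents :: "'f set"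
  far :: "'f \<Rightarrow> nat"
  init :: "('a, 'f, 'n) fm set"
  pre :: "'a \<Rightarrow> ('a, 'f, 'n) fm"
  ssa :: "'f \<Rightarrow> ('a, 'f, 'n) fm"

fun atm_over :: "('a, 'f, 'n) bat \<Rightarrow> ('a, 'n) atm \<Rightarrow> bool" where
  "atm_over D (AVar v) \<longleftrightarrow> True"
| "atm_over D (Act A ts) \<longleftrightarrow> A \<in> set (acts D) \<and> length ts = aar D A"

primrec fm_over :: "('a, 'f, 'n) bat \<Rightarrow> ('a, 'f, 'n) fm \<Rightarrow> bool" where
  "fm_over D FTrue \<longleftrightarrow> True"
| "fm_over D (Fluent F ts) \<longleftrightarrow> F \<in> fluents D \<and> length ts = far D F"
| "fm_over D (EqO t u) \<longleftrightarrow> True"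
| "fm_over D (EqA a b) \<longleftrightarrow> atm_over D a \<and> atm_over D b"
| "fm_over D (Neg p) \<longleftrightarrow> fm_over D p"
| "fm_over D (Conj p q) \<longleftrightarrow> fm_over D p \<and> fm_over D q"
| "fm_over D (FEx x p) \<longleftrightarrow> fm_over D p"
| "fm_over D (FAEx v p) \<longleftrightarrow> fm_over D p"

primrec prog_over :: "('a, 'f, 'n) bat \<Rightarrow> ('a, 'f, 'n) prog \<Rightarrow> bool" where
  "prog_over D (Prim A ts) \<longleftrightarrow> A \<in> set (acts D) \<and> length ts = aar D A"
| "prog_over D (Test p) \<longleftrightarrow> fm_over D p \<and> afv p = {}"
| "prog_over D (Seq d e) \<longleftrightarrow> prog_over D d \<and> prog_over D e"
| "prog_over D (Choice d e) \<longleftrightarrow> prog_over D d \<and> prog_over D e"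
| "prog_over D (Pi x d) \<longleftrightarrow> prog_over D d"
| "prog_over D (Star d) \<longleftrightarrow> prog_over D d"
| "prog_over D (Conc d e) \<longleftrightarrow> prog_over D d \<and> prog_over D e"

definition closed_prog :: "('a, 'f, 'n) bat \<Rightarrow> ('a, 'f, 'n) prog \<Rightarrow> bool" where
  "closed_prog D d \<longleftrightarrow> prog_over D d \<and> pfv d = {}"

definition is_bat :: "('a, 'f, 'n) bat \<Rightarrow> bool" where
  "is_bat D \<longleftrightarrow>
     distinct (acts D) \<and> finite (fluents D) \<and>
     (\<forall>p\<in>init D. fm_over D p \<and> fv p = {} \<and> afv p = {}) \<and>
     (\<forall>A\<in>set (acts D). fm_over D (pre D A) \<and> fv (pre D A) \<subseteq> {..<aar D A} \<and> afv (pre D A) = {}) \<and>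
     (\<forall>F\<in>fluents D. fm_over D (ssa D F) \<and> fv (ssa D F) \<subseteq> {..<far D F} \<and> afv (ssa D F) \<subseteq> {0})"

section \<open>Structures\<close>

record ('a, 'f, 'n, 'o, 'e, 's) struct =
  obj :: "'n \<Rightarrow> 'o"
  act :: "'a \<Rightarrow> 'o list \<Rightarrow> 'e"
  S0 :: 's
  doS :: "'e \<Rightarrow> 's \<Rightarrow> 's"
  prec :: "'s \<Rightarrow> 's \<Rightarrow> bool"
  Poss :: "'e \<Rightarrow> 's \<Rightarrow> bool"
  holds :: "'f \<Rightarrow> 'o list \<Rightarrow> 's \<Rightarrow> bool"
  Trans :: "('a, 'f, 'n) prog \<Rightarrow> 's \<Rightarrow> ('a, 'f, 'n) prog \<Rightarrow> 's \<Rightarrow> bool"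
  Final :: "('a, 'f, 'n) prog \<Rightarrow> 's \<Rightarrow> bool"

fun tval :: "('a, 'f, 'n, 'o, 'e, 's) struct \<Rightarrow> (var \<Rightarrow> 'o) \<Rightarrow> 'n tm \<Rightarrow> 'o" where
  "tval M e (Var x) = e x"
| "tval M e (Name n) = obj M n"

fun atval :: "('a, 'f, 'n, 'o, 'e, 's) struct \<Rightarrow> (var \<Rightarrow> 'o) \<Rightarrow> (var \<Rightarrow> 'e) \<Rightarrow> ('a, 'n) atm \<Rightarrow> 'e" where
  "atval M e g (AVar v) = g v"
| "atval M e g (Act A ts) = act M A (map (tval M e) ts)"

text \<open>\<open>sat M e g s p\<close>: the formula \<open>p[s]\<close> is true in \<open>M\<close> under the object assignment \<open>e\<close>
  and the action assignment \<open>g\<close>.\<close>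

primrec sat :: "('a, 'f, 'n, 'o, 'e, 's) struct \<Rightarrow> (var \<Rightarrow> 'o) \<Rightarrow> (var \<Rightarrow> 'e) \<Rightarrow> 's
    \<Rightarrow> ('a, 'f, 'n) fm \<Rightarrow> bool" where
  "sat M e g s FTrue \<longleftrightarrow> True"
| "sat M e g s (Fluent F ts) \<longleftrightarrow> holds M F (map (tval M e) ts) s"
| "sat M e g s (EqO t u) \<longleftrightarrow> tval M e t = tval M e u"
| "sat M e g s (EqA a b) \<longleftrightarrow> atval M e g a = atval M e g b"
| "sat M e g s (Neg p) \<longleftrightarrow> \<not> sat M e g s p"
| "sat M e g s (Conj p q) \<longleftrightarrow> sat M e g s p \<and> sat M e g s q"
| "sat M e g s (FEx x p) \<longleftrightarrow> (\<exists>u. sat M (e(x := u)) g s p)"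
| "sat M e g s (FAEx v p) \<longleftrightarrow> (\<exists>a. sat M e (g(v := a)) s p)"

definition sat_closed :: "('a, 'f, 'n, 'o, 'e, 's) struct \<Rightarrow> 's \<Rightarrow> ('a, 'f, 'n) fm \<Rightarrow> bool" where
  "sat_closed M s p \<longleftrightarrow> (\<forall>e g. sat M e g s p)"

section \<open>The axioms\<close>

definition initial_axioms :: "('a, 'f, 'n) bat \<Rightarrow> ('a, 'f, 'n, 'o, 'e, 's) struct \<Rightarrow> bool" where
  "initial_axioms D M \<longleftrightarrow> (\<forall>p\<in>init D. sat_closed M (S0 M) p)"

text \<open>The tuple \<open>map e [0..<k]\<close> lists the values of the formal parameters, so that quantifying
  over the assignments \<open>e\<close> and \<open>g\<close> forms the universal closure of the axiom.\<close>

definition precondition_axioms :: "('a, 'f, 'n) bat \<Rightarrow> ('a, 'f, 'n, 'o, 'e, 's) struct \<Rightarrow> bool" where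
  "precondition_axioms D M \<longleftrightarrow>
     (\<forall>A\<in>set (acts D). \<forall>e g s.
        Poss M (act M A (map e [0..<aar D A])) s \<longleftrightarrow> sat M e g s (pre D A))"

definition successor_state_axioms :: "('a, 'f, 'n) bat \<Rightarrow> ('a, 'f, 'n, 'o, 'e, 's) struct \<Rightarrow> bool" where
  "successor_state_axioms D M \<longleftrightarrow>
     (\<forall>F\<in>fluents D. \<forall>e g s.
        holds M F (map e [0..<far D F]) (doS M (g 0) s) \<longleftrightarrow> sat M e g s (ssa D F))"

definition action_axioms :: "('a, 'f, 'n) bat \<Rightarrow> ('a, 'f, 'n, 'o, 'e, 's) struct \<Rightarrow> bool" where
  "action_axioms D M \<longleftrightarrow>
     (\<forall>A\<in>set (acts D). \<forall>B\<in>set (acts D). \<forall>us vs.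
        length us = aar D A \<and> length vs = aar D B \<and> act M A us = act M B vs \<longrightarrow> A = B \<and> us = vs) \<and>
     (\<forall>a. \<exists>A\<in>set (acts D). \<exists>us. length us = aar D A \<and> a = act M A us)"

definition object_axioms :: "('a, 'f, 'n, 'o, 'e, 's) struct \<Rightarrow> bool" where
  "object_axioms M \<longleftrightarrow> inj (obj M) \<and> surj (obj M)"

text \<open>The foundational axioms in Reiter's form; \<open>prec\<close> is the plain (executability-free)
  subhistory order.\<close>

definition foundational_axioms :: "('a, 'f, 'n, 'o, 'e, 's) struct \<Rightarrow> bool" where
  "foundational_axioms M \<longleftrightarrow>
     (\<forall>a b s t. doS M a s = doS M b t \<longrightarrow> a = b \<and> s = t) \<and>
     (\<forall>P. P (S0 M) \<and> (\<forall>a s. P s \<longrightarrow> P (doS M a s)) \<longrightarrow> (\<forall>s. P s)) \<and>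
     (\<forall>s. \<not> prec M s (S0 M)) \<and>
     (\<forall>a s t. prec M s (doS M a t) \<longleftrightarrow> prec M s t \<or> s = t)"

definition bat_model :: "('a, 'f, 'n) bat \<Rightarrow> ('a, 'f, 'n, 'o, 'e, 's) struct \<Rightarrow> bool" where
  "bat_model D M \<longleftrightarrow>
     initial_axioms D M \<and> precondition_axioms D M \<and> successor_state_axioms D M \<and>
     action_axioms D M \<and> object_axioms M \<and> foundational_axioms M"

text \<open>The sort of programs consists of the closed programs over the signature. Since every object
  is denoted by exactly one standard name, the quantifier in the axioms for \<open>Pi\<close> is read as
  ranging over the names substituted for the bound variable.\<close>

definition trans_axioms :: "('a, 'f, 'n) bat \<Rightarrow> ('a, 'f, 'n, 'o, 'e, 's) struct \<Rightarrow> bool" where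
  "trans_axioms D M \<longleftrightarrow>
     (\<forall>A ns s d' s'. closed_prog D (Prim A (map Name ns)) \<longrightarrow>
        (Trans M (Prim A (map Name ns)) s d' s' \<longleftrightarrow>
           s' = doS M (act M A (map (obj M) ns)) s \<and> Poss M (act M A (map (obj M) ns)) s \<and> d' = nil)) \<and>
     (\<forall>p s d' s'. closed_prog D (Test p) \<longrightarrow>
        (Trans M (Test p) s d' s' \<longleftrightarrow> False)) \<and>
     (\<forall>d1 d2 s d' s'. closed_prog D (Seq d1 d2) \<longrightarrow>
        (Trans M (Seq d1 d2) s d' s' \<longleftrightarrow>
           (\<exists>d1'. Trans M d1 s d1' s' \<and> d' = Seq d1' d2) \<or> (Final M d1 s \<and> Trans M d2 s d' s'))) \<and>
     (\<forall>d1 d2 s d' s'. closed_prog D (Choice d1 d2) \<longrightarrow>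
        (Trans M (Choice d1 d2) s d' s' \<longleftrightarrow> Trans M d1 s d' s' \<or> Trans M d2 s d' s')) \<and>
     (\<forall>x d s d' s'. closed_prog D (Pi x d) \<longrightarrow>
        (Trans M (Pi x d) s d' s' \<longleftrightarrow> (\<exists>n. Trans M (psubst x n d) s d' s'))) \<and>
     (\<forall>d s d' s'. closed_prog D (Star d) \<longrightarrow>
        (Trans M (Star d) s d' s' \<longleftrightarrow> (\<exists>d''. Trans M d s d'' s' \<and> d' = Seq d'' (Star d)))) \<and>
     (\<forall>d1 d2 s d' s'. closed_prog D (Conc d1 d2) \<longrightarrow>
        (Trans M (Conc d1 d2) s d' s' \<longleftrightarrow>
           (\<exists>d1'. Trans M d1 s d1' s' \<and> d' = Conc d1' d2) \<or>
           (\<exists>d2'. Trans M d2 s d2' s' \<and> d' = Conc d1 d2')))"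

definition final_axioms :: "('a, 'f, 'n) bat \<Rightarrow> ('a, 'f, 'n, 'o, 'e, 's) struct \<Rightarrow> bool" where
  "final_axioms D M \<longleftrightarrow>
     (\<forall>A ts s. closed_prog D (Prim A ts) \<longrightarrow> (Final M (Prim A ts) s \<longleftrightarrow> False)) \<and>
     (\<forall>p s. closed_prog D (Test p) \<longrightarrow> (Final M (Test p) s \<longleftrightarrow> sat_closed M s p)) \<and>
     (\<forall>d1 d2 s. closed_prog D (Seq d1 d2) \<longrightarrow>
        (Final M (Seq d1 d2) s \<longleftrightarrow> Final M d1 s \<and> Final M d2 s)) \<and>
     (\<forall>d1 d2 s. closed_prog D (Choice d1 d2) \<longrightarrow>
        (Final M (Choice d1 d2) s \<longleftrightarrow> Final M d1 s \<or> Final M d2 s)) \<and>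
     (\<forall>x d s. closed_prog D (Pi x d) \<longrightarrow>
        (Final M (Pi x d) s \<longleftrightarrow> (\<exists>n. Final M (psubst x n d) s))) \<and>
     (\<forall>d s. closed_prog D (Star d) \<longrightarrow> (Final M (Star d) s \<longleftrightarrow> True)) \<and>
     (\<forall>d1 d2 s. closed_prog D (Conc d1 d2) \<longrightarrow>
        (Final M (Conc d1 d2) s \<longleftrightarrow> Final M d1 s \<and> Final M d2 s))"

text \<open>\<open>entails D \<Phi>\<close>: the theory \<open>D\<close> together with the ConGolog axioms entails \<open>\<Phi>\<close>, where a
  formula is given by its truth value in each structure. Structures range over all
  interpretations on the (arbitrary) types \<open>'o\<close>, \<open>'e\<close>, \<open>'s\<close>.\<close>

definition entails :: "('a, 'f, 'n) bat \<Rightarrow> (('a, 'f, 'n, 'o, 'e, 's) struct \<Rightarrow> bool) \<Rightarrow> bool" where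
  "entails D \<Phi> \<longleftrightarrow> (\<forall>M. bat_model D M \<and> trans_axioms D M \<and> final_axioms D M \<longrightarrow> \<Phi> M)"

section \<open>Executions\<close>

definition sit_less :: "('a, 'f, 'n, 'o, 'e, 's) struct \<Rightarrow> 's \<Rightarrow> 's \<Rightarrow> bool" where
  "sit_less M = (\<lambda>s s'. \<exists>a. Poss M a s \<and> s' = doS M a s)\<^sup>+\<^sup>+"

definition sit_le :: "('a, 'f, 'n, 'o, 'e, 's) struct \<Rightarrow> 's \<Rightarrow> 's \<Rightarrow> bool" where
  "sit_le M s s' \<longleftrightarrow> s = s' \<or> sit_less M s s'"

text \<open>A situation that is not executable has no executable prefix with respect to \<open>sit_le\<close>,
  and hence no largest prefix in the sense of \<open>lp\<close> below.\<close>

definition executable :: "('a, 'f, 'n, 'o, 'e, 's) struct \<Rightarrow> 's \<Rightarrow> bool" where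
  "executable M s \<longleftrightarrow> sit_le M (S0 M) s"

definition TransStar :: "('a, 'f, 'n, 'o, 'e, 's) struct \<Rightarrow> ('a, 'f, 'n) prog \<Rightarrow> 's
    \<Rightarrow> ('a, 'f, 'n) prog \<Rightarrow> 's \<Rightarrow> bool" where
  "TransStar M d s d' s' \<longleftrightarrow> (\<lambda>(d, s) (d', s'). Trans M d s d' s')\<^sup>*\<^sup>* (d, s) (d', s')"

definition Do :: "('a, 'f, 'n, 'o, 'e, 's) struct \<Rightarrow> ('a, 'f, 'n) prog \<Rightarrow> 's \<Rightarrow> 's \<Rightarrow> bool" where
  "Do M d s s' \<longleftrightarrow> (\<exists>d'. TransStar M d s d' s' \<and> Final M d' s')"

definition situation_determined ::
    "('a, 'f, 'n, 'o, 'e, 's) struct \<Rightarrow> ('a, 'f, 'n) prog \<Rightarrow> 's \<Rightarrow> bool" where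
  "situation_determined M d s \<longleftrightarrow>
     (\<forall>s' d' d''. TransStar M d s d' s' \<and> TransStar M d s d'' s' \<longrightarrow> d' = d'')"

section \<open>Refinement mappings\<close>

record ('h, 'k, 'a, 'f, 'n) refinement =
  mact :: "'h \<Rightarrow> ('a, 'f, 'n) prog"
  mfluent :: "'k \<Rightarrow> ('a, 'f, 'n) fm"

text \<open>The first argument only names the type of structures over which the entailment in the
  last conjunct ranges.\<close>

definition refinement_mapping :: "('a, 'f, 'n, 'o, 'e, 's) struct itself \<Rightarrow> ('h, 'k, 'n) bat
    \<Rightarrow> ('a, 'f, 'n) bat \<Rightarrow> ('h, 'k, 'a, 'f, 'n) refinement \<Rightarrow> bool" where
  "refinement_mapping T Dh Dl m \<longleftrightarrow>
     (\<forall>A\<in>set (acts Dh). prog_over Dl (mact m A) \<and> pfv (mact m A) \<subseteq> {..<aar Dh A}) \<and>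
     (\<forall>F\<in>fluents Dh. fm_over Dl (mfluent m F) \<and> fv (mfluent m F) \<subseteq> {..<far Dh F}
        \<and> afv (mfluent m F) = {}) \<and>
     (\<forall>A\<in>set (acts Dh). entails Dl (\<lambda>M :: ('a, 'f, 'n, 'o, 'e, 's) struct.
        \<forall>ns s. length ns = aar Dh A \<longrightarrow> situation_determined M (inst ns (mact m A)) s))"

text \<open>The empty choice is the program that can neither make a step nor terminate.\<close>

fun choice_list :: "('a, 'f, 'n) prog list \<Rightarrow> ('a, 'f, 'n) prog" where
  "choice_list [] = Test (Neg FTrue)"
| "choice_list [d] = d"
| "choice_list (d # d' # ds) = Choice d (choice_list (d' # ds))"

definition any1hl :: "('h, 'k, 'n) bat \<Rightarrow> ('h, 'k, 'a, 'f, 'n) refinement \<Rightarrow> ('a, 'f, 'n) prog" where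
  "any1hl Dh m = choice_list (map (\<lambda>A. foldr Pi [0..<aar Dh A] (mact m A)) (acts Dh))"

definition anyseqhl :: "('h, 'k, 'n) bat \<Rightarrow> ('h, 'k, 'a, 'f, 'n) refinement \<Rightarrow> ('a, 'f, 'n) prog" where
  "anyseqhl Dh m = Star (any1hl Dh m)"

definition lp :: "('a, 'f, 'n, 'o, 'e, 's) struct \<Rightarrow> ('h, 'k, 'n) bat
    \<Rightarrow> ('h, 'k, 'a, 'f, 'n) refinement \<Rightarrow> 's \<Rightarrow> 's \<Rightarrow> bool" where
  "lp M Dh m s s' \<longleftrightarrow>
     Do M (anyseqhl Dh m) (S0 M) s' \<and> sit_le M s' s \<and>
     (\<forall>s''. sit_less M s' s'' \<and> sit_le M s'' s \<longrightarrow> \<not> Do M (anyseqhl Dh m) (S0 M) s'')"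

end

theory Submission
  imports Defs
begin

text \<open>Backwards along executable steps, every situation has at most one predecessor, so the
  executable prefixes of a situation form a finite chain. The empty execution makes
  \<open>S\<^sub>0\<close> a producible prefix of every executable situation; the last producible prefix on the chain
  is the largest one, and two largest ones would be comparable.\<close>

text \<open>Going backwards from \<open>z\<close> there is only one way to walk, so both paths run
  along the same chain. The induction peels off the last step, which the two paths share unless
  \<open>y\<close> is already the endpoint.\<close>

lemma rtranclp_comparable_if_left_unique:
  assumes "left_unique r" and "r\<^sup>*\<^sup>* x z" and "r\<^sup>*\<^sup>* y z"
  shows "r\<^sup>*\<^sup>* x y \<or> r\<^sup>*\<^sup>* y x"
  using assms(2,3)
proof (induction arbitrary: y rule: rtranclp_induct)
  case base
  then show ?case by blast
next
  case (step u v)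
  show ?case
  proof (cases "y = v")
    case True
    with step.hyps show ?thesis by (meson rtranclp.rtrancl_into_rtrancl)
  next
    case False
    with step.prems obtain w where "r\<^sup>*\<^sup>* y w" "r w v"
      by (metis rtranclp.cases)
    moreover from this step.hyps(2) have "w = u"
      using assms(1) by (blast dest: left_uniqueD)
    ultimately show ?thesis using step.IH by blast
  qed
qed

lemma ex_last_on_path:
  assumes "left_unique r" and acyclic: "\<And>x. \<not> r\<^sup>+\<^sup>+ x x"
    and "P x" and "r\<^sup>*\<^sup>* x z"
  shows "\<exists>y. P y \<and> r\<^sup>*\<^sup>* y z \<and> (\<forall>w. r\<^sup>+\<^sup>+ y w \<and> r\<^sup>*\<^sup>* w z \<longrightarrow> \<not> P w)"
  using assms(4)
proof (induction rule: rtranclp_induct)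
  case base
  \<comment> \<open>On the trivial path nothing can lie strictly beyond \<open>x\<close>, since such
    a \<open>w\<close> would close a cycle.\<close>
  have "\<not> (r\<^sup>+\<^sup>+ x w \<and> r\<^sup>*\<^sup>* w x)" for w
    using acyclic by (meson tranclp_rtranclp_tranclp)
  with assms(3) show ?case by blast
next
  case (step u v)
  show ?case
  proof (cases "P v")
    case True
    have "\<not> (r\<^sup>+\<^sup>+ v w \<and> r\<^sup>*\<^sup>* w v)" for w
      using acyclic by (meson tranclp_rtranclp_tranclp)
    with True show ?thesis by blast
  next
    case False
    from step.IH obtain y where y: "P y" "r\<^sup>*\<^sup>* y u"
      "\<And>w. r\<^sup>+\<^sup>+ y w \<Longrightarrow> r\<^sup>*\<^sup>* w u \<Longrightarrow> \<not> P w" by blast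
    \<comment> \<open>The old witness \<open>y\<close> survives the extension to \<open>v\<close>:
      any other \<open>w\<close> that reaches \<open>v\<close> must pass through its only
      predecessor \<open>u\<close>, where the induction hypothesis applies.\<close>
    have "\<not> P w" if "r\<^sup>+\<^sup>+ y w" "r\<^sup>*\<^sup>* w v" for w
    proof (cases "w = v")
      case True
      with False show ?thesis by simp
    next
      case False
      with that(2) obtain w' where "r\<^sup>*\<^sup>* w w'" "r w' v"
        by (metis rtranclp.cases)
      moreover from this step.hyps(2) have "w' = u"
        using assms(1) by (blast dest: left_uniqueD)
      ultimately show ?thesis using y(3) that(1) by blast
    qed
    with y step.hyps(2) show ?thesis by (meson rtranclp.rtrancl_into_rtrancl)
  qed
qed

abbreviation exec_step :: "('a, 'f, 'n, 'o, 'e, 's) struct \<Rightarrow> 's \<Rightarrow> 's \<Rightarrow> bool" where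
  "exec_step M \<equiv> \<lambda>s s'. \<exists>a. Poss M a s \<and> s' = doS M a s"

lemma sit_le_iff_rtranclp: "sit_le M s t \<longleftrightarrow> (exec_step M)\<^sup>*\<^sup>* s t"
  unfolding sit_le_def sit_less_def by (blast dest: rtranclpD intro: tranclp_into_rtranclp)

lemma situation_induct:
  assumes "foundational_axioms M" and "P (S0 M)" and "\<And>a s. P s \<Longrightarrow> P (doS M a s)"
  shows "P s"
proof -
  have "\<forall>P. P (S0 M) \<and> (\<forall>a s. P s \<longrightarrow> P (doS M a s)) \<longrightarrow> (\<forall>s. P s)"
    using assms(1) unfolding foundational_axioms_def by (elim conjE)
  from spec[OF this, of P] assms(2,3) show ?thesis by blast
qed

lemma left_unique_exec_step:
  assumes "foundational_axioms M"
  shows "left_unique (exec_step M)"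
proof -
  have "\<forall>a b s t. doS M a s = doS M b t \<longrightarrow> a = b \<and> s = t"
    using assms unfolding foundational_axioms_def by (elim conjE)
  then show ?thesis unfolding left_unique_def by metis
qed

lemma prec_doS_iff:
  assumes "foundational_axioms M"
  shows "prec M s (doS M a t) \<longleftrightarrow> prec M s t \<or> s = t"
proof -
  have "\<forall>a s t. prec M s (doS M a t) \<longleftrightarrow> prec M s t \<or> s = t"
    using assms unfolding foundational_axioms_def by (elim conjE)
  then show ?thesis by blast
qed

lemma not_prec_S0:
  assumes "foundational_axioms M"
  shows "\<not> prec M s (S0 M)"
proof -
  have "\<forall>s. \<not> prec M s (S0 M)"
    using assms unfolding foundational_axioms_def by (elim conjE)
  then show ?thesis by blast
qed

lemma prec_trans:
  assumes "foundational_axioms M" and "prec M s t" and "prec M t u"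
  shows "prec M s u"
  using assms(3)
proof (induction u rule: situation_induct[OF assms(1)])
  case 1
  then show ?case using not_prec_S0[OF assms(1)] by blast
next
  case (2 a u)
  then show ?case using assms(2) by (auto simp: prec_doS_iff[OF assms(1)])
qed

text \<open>This is the source of acyclicity. Since \<open>s\<close> precedes
  \<open>doS M a s\<close>, a loop at \<open>doS M a s\<close> would yield one at \<open>s\<close>,
  by transitivity or because the two situations coincide.\<close>

lemma prec_irrefl:
  assumes "foundational_axioms M"
  shows "\<not> prec M s s"
proof (induction s rule: situation_induct[OF assms])
  case 1
  show ?case by (rule not_prec_S0[OF assms])
next
  case (2 a s)
  have "prec M s (doS M a s)" by (simp add: prec_doS_iff[OF assms])
  with 2 show ?case by (metis prec_doS_iff[OF assms] prec_trans[OF assms])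
qed

text \<open>Executability only restricts which \<open>doS\<close> steps count, so irreflexivity
  carries over from \<open>prec\<close> to \<open>sit_less\<close>.\<close>

lemma prec_if_sit_less:
  assumes "foundational_axioms M" and "sit_less M s t"
  shows "prec M s t"
  using assms(2) unfolding sit_less_def
  by (induction rule: tranclp_induct) (auto simp: prec_doS_iff[OF assms(1)])

lemma sit_less_irrefl:
  assumes "foundational_axioms M"
  shows "\<not> sit_less M s s"
proof
  assume "sit_less M s s"
  then have "prec M s s" by (rule prec_if_sit_less[OF assms])
  with prec_irrefl[OF assms] show False by (rule notE)
qed

lemma prog_over_foldr_Pi: "prog_over D (foldr Pi xs d) \<longleftrightarrow> prog_over D d"
  by (induction xs) auto

lemma pfv_foldr_Pi: "pfv (foldr Pi xs d) = pfv d - set xs"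
  by (induction xs) auto

lemma closed_prog_choice_list:
  assumes "\<And>d. d \<in> set ds \<Longrightarrow> closed_prog D d"
  shows "closed_prog D (choice_list ds)"
  using assms by (induction ds rule: choice_list.induct) (auto simp: closed_prog_def)

text \<open>The axioms for \<open>Final\<close> constrain closed programs only, so this has to be
  secured before they can be used. The \<open>Pi\<close> prefix binds exactly the formal parameters
  that may occur free in \<open>mact m A\<close>.\<close>

lemma closed_prog_anyseqhl:
  assumes "refinement_mapping T Dh Dl m"
  shows "closed_prog Dl (anyseqhl Dh m)"
proof -
  have "closed_prog Dl (any1hl Dh m)"
    unfolding any1hl_def
  proof (rule closed_prog_choice_list)
    fix d
    assume "d \<in> set (map (\<lambda>A. foldr Pi [0..<aar Dh A] (mact m A)) (acts Dh))"
    then obtain A where A: "A \<in> set (acts Dh)" and d: "d = foldr Pi [0..<aar Dh A] (mact m A)"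
      by auto
    from A have "prog_over Dl (mact m A)" and "pfv (mact m A) \<subseteq> {..<aar Dh A}"
      using assms unfolding refinement_mapping_def by blast+
    then show "closed_prog Dl d"
      by (auto simp: d closed_prog_def prog_over_foldr_Pi pfv_foldr_Pi)
  qed
  then show ?thesis by (simp add: anyseqhl_def closed_prog_def)
qed

text \<open>Zero iterations suffice: an iteration is final in every situation.\<close>

lemma Do_anyseqhl_refl:
  assumes "refinement_mapping T Dh Dl m" and "final_axioms Dl M"
  shows "Do M (anyseqhl Dh m) s s"
proof -
  have "Final M (anyseqhl Dh m) s"
    using assms(2) closed_prog_anyseqhl[OF assms(1)]
    unfolding final_axioms_def anyseqhl_def by blast
  then show ?thesis unfolding Do_def TransStar_def by blast
qed

text \<open>Executability of \<open>s\<close> supplies the path from \<open>S0 M\<close> along which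
  the last producible situation is taken.\<close>

lemma ex_lp:
  assumes "foundational_axioms M" and "Do M (anyseqhl Dh m) (S0 M) (S0 M)" and "executable M s"
  shows "\<exists>s'. lp M Dh m s s'"
  using ex_last_on_path[OF left_unique_exec_step[OF assms(1)]
      sit_less_irrefl[OF assms(1), unfolded sit_less_def],
      of "Do M (anyseqhl Dh m) (S0 M)" "S0 M" s] assms(2,3)
  by (simp add: lp_def executable_def sit_le_iff_rtranclp sit_less_def)

lemma lp_unique:
  assumes "foundational_axioms M" and "lp M Dh m s s1" and "lp M Dh m s s2"
  shows "s1 = s2"
proof -
  have "sit_le M s1 s2 \<or> sit_le M s2 s1"
    using rtranclp_comparable_if_left_unique[OF left_unique_exec_step[OF assms(1)], of s1 s s2]
      assms(2,3)
    by (simp add: lp_def sit_le_iff_rtranclp)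
  \<comment> \<open>If one were strictly below the other, the later one would be a producible prefix
    of \<open>s\<close> contradicting the maximality of the earlier one.\<close>
  then show ?thesis using assms(2,3) unfolding lp_def sit_le_def by blast
qed

theorem theorem8:
  fixes Dh :: "('h, 'k, 'n::{countable, infinite}) bat"
    and Dl :: "('a, 'f, 'n) bat"
    and m :: "('h, 'k, 'a, 'f, 'n) refinement"
  assumes "is_bat Dh" and "is_bat Dl"
    and "refinement_mapping TYPE(('a, 'f, 'n, 'o, 'e, 's) struct) Dh Dl m"
  shows "entails Dl (\<lambda>M :: ('a, 'f, 'n, 'o, 'e, 's) struct.
           \<forall>s. executable M s \<longrightarrow> (\<exists>s'. lp M Dh m s s')) \<and>
         entails Dl (\<lambda>M :: ('a, 'f, 'n, 'o, 'e, 's) struct.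
           \<forall>s s1 s2. lp M Dh m s s1 \<and> lp M Dh m s s2 \<longrightarrow> s1 = s2)"
proof (unfold entails_def bat_model_def, intro conjI allI impI; elim conjE)
  fix M :: "('a, 'f, 'n, 'o, 'e, 's) struct" and s
  assume "foundational_axioms M" and "final_axioms Dl M" and "executable M s"
  then show "\<exists>s'. lp M Dh m s s'"
    by (intro ex_lp Do_anyseqhl_refl[OF assms(3)])
next
  fix M :: "('a, 'f, 'n, 'o, 'e, 's) struct" and s s1 s2
  assume "foundational_axioms M" and "lp M Dh m s s1" and "lp M Dh m s s2"
  then show "s1 = s2" by (rule lp_unique)
qed

end
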